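(* Let $\mathcal I$ be an ideal on a set $X$. Then: (i) the map $j=\exp id_X\colon \exp X_{\mathcal I}\to\exp X_{\mathcal I\text{-}ary}$ (the identity of $\mathcal P(X)$) is coarse, but it is not an asymorphism; (ii) the identity map $j$ of $\mathcal P(X)$, viewed as a map $j\colon\exp X_{\mathcal I\text{-}ary}\to\mathbb C(X,\mathcal I)$, is coarse, but it is not an asymorphism; (iii) the restriction $i=id_X^\flat\colon X_{\mathcal I}^\flat\to X_{\mathcal I\text{-}ary}^\flat$ of $\exp id_X$ is coarse, but it is not an asymorphism.
   Context: A ballean is a triple $\mathcal B=(X,P,B)$ where $X$ (the support) and $P\neq\emptyset$ (the radii set) are sets and $B\colon X\times P\to\mathcal P(X)$ is a map such that: $x\in B(x,\alpha)$ for all $x,\alpha$; $x\in B(y,\alpha)$ iff $y\in B(x,\alpha)$; for all $\alpha,\beta\in P$ there is $\gamma\in P$ with $B(B(x,\alpha),\beta)\subseteq B(x,\gamma)$ for all $x\in X$, where $B(A,\delta)=\bigcup_{y\in A}B(y,\delta)$. The subballean on $Y\subseteq X$ is $(Y,P,B_Y)$ with $B_Y(y,\alpha)=B(y,\alpha)\cap Y$. A subset $A\subseteq X$ is bounded if there is $\alpha\in P$ with $A\subseteq B(y,\alpha)$ for every $y\in A$. A map $f\colon X\to Y$ between balleans $(X,P_X,B_X)$, $(Y,P_Y,B_Y)$ is coarse if for every $\alpha\in P_X$ there is $\beta\in P_Y$ with $f(B_X(x,\alpha))\subseteq B_Y(f(x),\beta)$ for all $x\in X$; it is an asymorphism if it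 is bijective and both $f$ and $f^{-1}$ are coarse. An ideal $\mathcal I$ on $X$ is a family of subsets of $X$ closed under finite unions and subsets; it is always assumed that $X\notin\mathcal I$ and that $\mathcal I$ contains all finite subsets of $X$ (so $X$ is infinite). The $\mathcal I$-ary ballean $X_{\mathcal I\text{-}ary}=(X,\mathcal I,B_{\mathcal I\text{-}ary})$ has balls $B_{\mathcal I\text{-}ary}(x,A)=\{x\}\cup A$. The point ideal ballean $X_{\mathcal I}=(X,\mathcal I,B_{\mathcal I})$ has balls $B_{\mathcal I}(x,A)=\{x\}$ if $x\notin A$ and $B_{\mathcal I}(x,A)=A$ if $x\in A$. The hyperballean of $(X,P,B)$ is $\exp(\mathcal B)=(\mathcal P(X),P,\exp B)$, with $\exp B(A,\alpha)=\{C\in\mathcal P(X)\mid A\subseteq B(C,\alpha),\ C\subseteq B(A,\alpha)\}$; $\mathcal B^\flat$ (or $X^\flat$) is its subballean whose support is the family of all non-empty bounded subsets of $X$. For a map $f$, $\exp f(A)=f(A)$ and $f^\flat$ is the restriction of $\exp f$ to non-empty bounded subsets. The ballean $\mathbb C(X,\mathcal I)$ has support $\mathcal P(X)$ (identified with $\{0,1\}^X$ via characteristic functions), radii set $\mathcal I$ and balls $B_{\mathbb C}(A,K)=\{Y\subseteq X\mid A\setminus K\subseteq Y\subseteq A\cup K\}$. *)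

theory Defs
  imports "HOL-Library.FuncSet"
begin

record ('a, 'r) ball_structure =
  support :: "'a set"
  radii :: "'r set"
  ball :: "'a \<Rightarrow> 'r \<Rightarrow> 'a set"

(* The set ball B x r is only meaningful for x in support B and r in radii B. *)

definition ball_set :: "('a, 'r) ball_structure \<Rightarrow> 'a set \<Rightarrow> 'r \<Rightarrow> 'a set" where
  "ball_set B A r = (\<Union>y\<in>A. ball B y r)"

definition ballean :: "('a, 'r) ball_structure \<Rightarrow> bool" where
  "ballean B \<longleftrightarrow>
     radii B \<noteq> {} \<and>
     (\<forall>x\<in>support B. \<forall>r\<in>radii B. ball B x r \<subseteq> support B) \<and>
     (\<forall>x\<in>support B. \<forall>r\<in>radii B. x \<in> ball B x r) \<and>
     (\<forall>x\<in>support B. \<forall>y\<in>support B. \<forall>r\<in>radii B. x \<in> ball B y r \<longleftrightarrow> y \<in> ball B x r) \<and>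
     (\<forall>r\<in>radii B. \<forall>s\<in>radii B. \<exists>t\<in>radii B. \<forall>x\<in>support B.
        ball_set B (ball B x r) s \<subseteq> ball B x t)"

definition subballean :: "('a, 'r) ball_structure \<Rightarrow> 'a set \<Rightarrow> ('a, 'r) ball_structure" where
  "subballean B Y = \<lparr>support = Y, radii = radii B, ball = (\<lambda>y r. ball B y r \<inter> Y)\<rparr>"

definition bounded :: "('a, 'r) ball_structure \<Rightarrow> 'a set \<Rightarrow> bool" where
  "bounded B A \<longleftrightarrow> A \<subseteq> support B \<and> (\<exists>r\<in>radii B. \<forall>y\<in>A. A \<subseteq> ball B y r)"

definition coarse ::
  "('a, 'r) ball_structure \<Rightarrow> ('b, 's) ball_structure \<Rightarrow> ('a \<Rightarrow> 'b) \<Rightarrow> bool" where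
  "coarse B C f \<longleftrightarrow>
     f \<in> support B \<rightarrow> support C \<and>
     (\<forall>r\<in>radii B. \<exists>s\<in>radii C. \<forall>x\<in>support B. f ` ball B x r \<subseteq> ball C (f x) s)"

definition asymorphism ::
  "('a, 'r) ball_structure \<Rightarrow> ('b, 's) ball_structure \<Rightarrow> ('a \<Rightarrow> 'b) \<Rightarrow> bool" where
  "asymorphism B C f \<longleftrightarrow>
     bij_betw f (support B) (support C) \<and>
     coarse B C f \<and>
     coarse C B (inv_into (support B) f)"

definition hyperballean :: "('a, 'r) ball_structure \<Rightarrow> ('a set, 'r) ball_structure" where
  "hyperballean B =
     \<lparr>support = Pow (support B), radii = radii B,
      ball = (\<lambda>A r. {C \<in> Pow (support B). A \<subseteq> ball_set B C r \<and> C \<subseteq> ball_set B A r})\<rparr>"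

definition flat :: "('a, 'r) ball_structure \<Rightarrow> ('a set, 'r) ball_structure" where
  "flat B = subballean (hyperballean B) {A. A \<noteq> {} \<and> bounded B A}"

definition exp_map :: "('a \<Rightarrow> 'b) \<Rightarrow> 'a set \<Rightarrow> 'b set" where
  "exp_map f = (\<lambda>A. f ` A)"

definition flat_map :: "('a, 'r) ball_structure \<Rightarrow> ('a \<Rightarrow> 'b) \<Rightarrow> 'a set \<Rightarrow> 'b set" where
  "flat_map B f = restrict (exp_map f) (support (flat B))"

definition set_ideal :: "'a set \<Rightarrow> 'a set set \<Rightarrow> bool" where
  "set_ideal X I \<longleftrightarrow>
     I \<subseteq> Pow X \<and>
     (\<forall>A\<in>I. \<forall>B\<in>I. A \<union> B \<in> I) \<and>
     (\<forall>A\<in>I. \<forall>B. B \<subseteq> A \<longrightarrow> B \<in> I) \<and>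
     X \<notin> I \<and>
     (\<forall>F. finite F \<and> F \<subseteq> X \<longrightarrow> F \<in> I)"

(* These balls are not symmetric, so this structure is not literally a ballean.  Coarse maps
   are nevertheless only considered between its hyperballean and subballeans thereof, which
   are balleans: see ballean_hyperballean_ary and ballean_flat_ary below. *)
definition ary_ballean :: "'a set \<Rightarrow> 'a set set \<Rightarrow> ('a, 'a set) ball_structure" where
  "ary_ballean X I = \<lparr>support = X, radii = I, ball = (\<lambda>x A. {x} \<union> A)\<rparr>"

definition point_ballean :: "'a set \<Rightarrow> 'a set set \<Rightarrow> ('a, 'a set) ball_structure" where
  "point_ballean X I =
     \<lparr>support = X, radii = I, ball = (\<lambda>x A. if x \<in> A then A else {x})\<rparr>"

definition cantor_ballean :: "'a set \<Rightarrow> 'a set set \<Rightarrow> ('a set, 'a set) ball_structure" where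
  "cantor_ballean X I =
     \<lparr>support = Pow X, radii = I,
      ball = (\<lambda>A K. {Y \<in> Pow X. A - K \<subseteq> Y \<and> Y \<subseteq> A \<union> K})\<rparr>"

lemma ballean_subballean:
  assumes "ballean B" "Y \<subseteq> support B"
  shows "ballean (subballean B Y)"
proof -
  have comp: "\<forall>r\<in>radii B. \<forall>s\<in>radii B. \<exists>t\<in>radii B. \<forall>x\<in>support B.
      ball_set B (ball B x r) s \<subseteq> ball B x t"
    and refl: "\<forall>x\<in>support B. \<forall>r\<in>radii B. x \<in> ball B x r"
    and sym: "\<forall>x\<in>support B. \<forall>y\<in>support B. \<forall>r\<in>radii B. x \<in> ball B y r \<longleftrightarrow> y \<in> ball B x r"
    and ne: "radii B \<noteq> {}"
    using assms(1) unfolding ballean_def by argo+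
  have "\<exists>t\<in>radii B. \<forall>x\<in>Y. (\<Union>y\<in>ball B x r \<inter> Y. ball B y s \<inter> Y) \<subseteq> ball B x t \<inter> Y"
    if rs: "r \<in> radii B" "s \<in> radii B" for r s
  proof -
    obtain t where "t \<in> radii B" "\<forall>x\<in>support B. (\<Union>y\<in>ball B x r. ball B y s) \<subseteq> ball B x t"
      using comp rs unfolding ball_set_def by meson
    then show ?thesis using assms(2) by blast
  qed
  moreover have "\<forall>x\<in>Y. \<forall>y\<in>Y. \<forall>r\<in>radii B. x \<in> ball B y r \<longleftrightarrow> y \<in> ball B x r"
    using sym assms(2) by (meson subsetD)
  moreover have "\<forall>x\<in>Y. \<forall>r\<in>radii B. x \<in> ball B x r"
    using refl assms(2) by (meson subsetD)
  ultimately show ?thesis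
    using ne unfolding ballean_def subballean_def ball_set_def by simp
qed

lemma ball_set_mono: "A \<subseteq> C \<Longrightarrow> ball_set B A r \<subseteq> ball_set B C r"
  by (auto simp: ball_set_def)

lemma ballean_hyperballean_if:
  assumes ne: "radii B \<noteq> {}"
    and refl: "\<And>x r. x \<in> support B \<Longrightarrow> r \<in> radii B \<Longrightarrow> x \<in> ball B x r"
    and comp: "\<And>r s. r \<in> radii B \<Longrightarrow> s \<in> radii B \<Longrightarrow>
      \<exists>t\<in>radii B. \<forall>A\<subseteq>support B. ball_set B (ball_set B A r) s \<union> ball_set B (ball_set B A s) r
        \<subseteq> ball_set B A t"
  shows "ballean (hyperballean B)"
proof -
  let ?b = "\<lambda>A r. {C \<in> Pow (support B). A \<subseteq> ball_set B C r \<and> C \<subseteq> ball_set B A r}"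
  have "\<exists>t\<in>radii B. \<forall>A\<in>Pow (support B). (\<Union>C\<in>?b A r. ?b C s) \<subseteq> ?b A t"
    if rs: "r \<in> radii B" "s \<in> radii B" for r s
  proof -
    obtain t where t: "t \<in> radii B" "\<And>A. A \<subseteq> support B \<Longrightarrow>
        ball_set B (ball_set B A r) s \<union> ball_set B (ball_set B A s) r \<subseteq> ball_set B A t"
      using comp[OF rs] by blast
    have "D \<in> ?b A t" if "A \<subseteq> support B" "C \<in> ?b A r" "D \<in> ?b C s" for A C D
    proof -
      have "A \<subseteq> ball_set B C r" "C \<subseteq> ball_set B D s" "D \<subseteq> ball_set B C s" "C \<subseteq> ball_set B A r"
        "D \<subseteq> support B"
        using that by auto
      then have "A \<subseteq> ball_set B (ball_set B D s) r" "D \<subseteq> ball_set B (ball_set B A r) s"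
        using ball_set_mono by (metis order_trans)+
      then show ?thesis using t(2)[OF \<open>A \<subseteq> support B\<close>] t(2)[OF \<open>D \<subseteq> support B\<close>] \<open>D \<subseteq> support B\<close>
        by blast
    qed
    then show ?thesis using t(1) by blast
  qed
  moreover have "A \<subseteq> ball_set B A r" if "A \<subseteq> support B" "r \<in> radii B" for A r
    using that refl unfolding ball_set_def by blast
  ultimately show ?thesis
    using ne unfolding ballean_def hyperballean_def ball_set_def by auto
qed

lemma set_idealD:
  assumes "set_ideal X I"
  shows "I \<noteq> {}" "\<And>A B. A \<in> I \<Longrightarrow> B \<in> I \<Longrightarrow> A \<union> B \<in> I" "\<And>A. A \<in> I \<Longrightarrow> A \<subseteq> X"
  using assms unfolding set_ideal_def by auto

lemma ballean_point_ballean: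
  assumes "set_ideal X I"
  shows "ballean (point_ballean X I)"
proof -
  have "\<exists>t\<in>I. \<forall>x\<in>X. ball_set (point_ballean X I) (ball (point_ballean X I) x r) s
      \<subseteq> ball (point_ballean X I) x t" if "r \<in> I" "s \<in> I" for r s
    using set_idealD(2)[OF assms that]
    by (intro bexI[of _ "r \<union> s"])
      (auto simp: ball_set_def point_ballean_def split: if_splits)
  moreover have "support (point_ballean X I) = X" "radii (point_ballean X I) = I"
    by (simp_all add: point_ballean_def)
  ultimately show ?thesis
    using set_idealD[OF assms] unfolding ballean_def
    by (auto simp: point_ballean_def split: if_splits)
qed

lemma ballean_hyperballean_point:
  assumes "set_ideal X I"
  shows "ballean (hyperballean (point_ballean X I))"
proof (rule ballean_hyperballean_if)
  fix r s assume "r \<in> radii (point_ballean X I)" "s \<in> radii (point_ballean X I)"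
  then have "r \<union> s \<in> I" using set_idealD(2)[OF assms] by (simp add: point_ballean_def)
  then show "\<exists>t\<in>radii (point_ballean X I). \<forall>A\<subseteq>support (point_ballean X I).
      ball_set (point_ballean X I) (ball_set (point_ballean X I) A r) s
      \<union> ball_set (point_ballean X I) (ball_set (point_ballean X I) A s) r
        \<subseteq> ball_set (point_ballean X I) A t"
    by (intro bexI[of _ "r \<union> s"])
      (auto simp: ball_set_def point_ballean_def split: if_splits)
qed (use set_idealD[OF assms] in \<open>auto simp: point_ballean_def\<close>)

lemma ballean_hyperballean_ary:
  assumes "set_ideal X I"
  shows "ballean (hyperballean (ary_ballean X I))"
proof (rule ballean_hyperballean_if)
  fix r s assume "r \<in> radii (ary_ballean X I)" "s \<in> radii (ary_ballean X I)"
  then have "r \<union> s \<in> I" using set_idealD(2)[OF assms] by (simp add: ary_ballean_def)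
  then show "\<exists>t\<in>radii (ary_ballean X I). \<forall>A\<subseteq>support (ary_ballean X I).
      ball_set (ary_ballean X I) (ball_set (ary_ballean X I) A r) s
      \<union> ball_set (ary_ballean X I) (ball_set (ary_ballean X I) A s) r
        \<subseteq> ball_set (ary_ballean X I) A t"
    by (intro bexI[of _ "r \<union> s"]) (auto simp: ball_set_def ary_ballean_def)
qed (use set_idealD[OF assms] in \<open>auto simp: ary_ballean_def\<close>)

lemma ballean_flat:
  assumes "ballean (hyperballean B)"
  shows "ballean (flat B)"
  unfolding flat_def using assms
  by (rule ballean_subballean) (auto simp: hyperballean_def bounded_def)

lemma ballean_flat_point: "set_ideal X I \<Longrightarrow> ballean (flat (point_ballean X I))"
  by (simp add: ballean_flat ballean_hyperballean_point)

lemma ballean_flat_ary: "set_ideal X I \<Longrightarrow> ballean (flat (ary_ballean X I))"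
  by (simp add: ballean_flat ballean_hyperballean_ary)

lemma ballean_cantor_ballean:
  assumes "set_ideal X I"
  shows "ballean (cantor_ballean X I)"
proof -
  have "\<exists>t\<in>I. \<forall>x\<in>Pow X. ball_set (cantor_ballean X I) (ball (cantor_ballean X I) x r) s
      \<subseteq> ball (cantor_ballean X I) x t" if "r \<in> I" "s \<in> I" for r s
    using set_idealD(2)[OF assms that]
    by (intro bexI[of _ "r \<union> s"]) (auto simp: ball_set_def cantor_ballean_def; blast)
  moreover have "support (cantor_ballean X I) = Pow X" "radii (cantor_ballean X I) = I"
    by (simp_all add: cantor_ballean_def)
  ultimately show ?thesis
    using set_idealD[OF assms] unfolding ballean_def
    by (auto simp: cantor_ballean_def)
qed

end

(* All three maps are identities, so coarseness amounts to comparing balls of equal radius.  The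
   inverses fail to be coarse because, for a fixed point y and all x, the sets {x, y} and {x} are
   {y}-close in the ary ballean, while closeness with radius s in the point ideal ballean forces
   x to be y or to lie in s; the ideal is proper, so x can avoid both.  In (ii), the empty set is
   isolated in every hyperballean but not in the Cantor ballean. *)
theory Submission
  imports Defs
begin

section \<open>Maps that fix every point of the support\<close>

text \<open>Each radius \<open>r\<close> of \<open>B\<close> is its own witness in \<open>C\<close>.
  The balls of \<open>B\<close> must stay inside \<open>support B\<close>, since only there is
  \<open>f\<close> known to fix points, and the image of a whole ball has to be computed.\<close>

lemma coarse_if_fixes:
  assumes "support B \<subseteq> support C" "\<And>x. x \<in> support B \<Longrightarrow> f x = x" "radii B \<subseteq> radii C"
    and "\<And>x r. x \<in> support B \<Longrightarrow> r \<in> radii B \<Longrightarrow> ball B x r \<subseteq> support B \<inter> ball C x r"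
  shows "coarse B C f"
  unfolding coarse_def
proof (intro conjI ballI)
  show "f \<in> support B \<rightarrow> support C" using assms(1,2) by auto
  fix r assume "r \<in> radii B"
  then show "\<exists>s\<in>radii C. \<forall>x\<in>support B. f ` ball B x r \<subseteq> ball C (f x) s"
    using assms(2-4) by (intro bexI[of _ r]) fastforce+
qed

text \<open>The inverse of \<open>f\<close> also fixes the support, so its coarseness becomes a
  comparison of balls. To refute an asymorphism it then suffices to find one radius \<open>r\<close>
  of \<open>C\<close> that no \<open>s\<close> dominates. Fixing is asked only on the support, so
  that the restricted function \<open>flat_map\<close> qualifies.\<close>

lemma asymorphism_fixesD:
  assumes "asymorphism B C f" "\<And>x. x \<in> support B \<Longrightarrow> f x = x" "r \<in> radii C"
  obtains s where "s \<in> radii B"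
    "\<And>x y. x \<in> support B \<Longrightarrow> y \<in> support B \<Longrightarrow> y \<in> ball C x r \<Longrightarrow> y \<in> ball B x s"
proof -
  have bij: "bij_betw f (support B) (support C)" and coarse: "coarse C B (inv_into (support B) f)"
    using assms(1) by (auto simp: asymorphism_def)
  have supp: "support C = support B"
    using bij assms(2) by (auto simp: bij_betw_def)
  have inv: "inv_into (support B) f x = x" if "x \<in> support B" for x
    using bij assms(2) that by (intro inv_into_f_eq) (auto simp: bij_betw_def)
  obtain s where s: "s \<in> radii B"
      "\<forall>x\<in>support C. inv_into (support B) f ` ball C x r \<subseteq> ball B (inv_into (support B) f x) s"
    using coarse assms(3) unfolding coarse_def by blast
  show ?thesis
  proof (rule that[OF s(1)])
    fix x y assume xy: "x \<in> support B" "y \<in> support B" "y \<in> ball C x r"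
    then have "inv_into (support B) f y \<in> ball B (inv_into (support B) f x) s"
      using s(2) supp by blast
    then show "y \<in> ball B x s" using inv xy by simp
  qed
qed

section \<open>Ideals and the avoidance of small sets\<close>

lemma set_ideal_finite: "set_ideal X I \<Longrightarrow> finite F \<Longrightarrow> F \<subseteq> X \<Longrightarrow> F \<in> I"
  by (simp add: set_ideal_def)

lemma set_ideal_subset: "set_ideal X I \<Longrightarrow> A \<in> I \<Longrightarrow> B \<subseteq> A \<Longrightarrow> B \<in> I"
  by (auto simp: set_ideal_def)

lemma set_ideal_insert:
  assumes "set_ideal X I" "A \<in> I" "y \<in> X"
  shows "insert y A \<in> I"
  using set_idealD(2)[OF assms(1) set_ideal_finite[OF assms(1), of "{y}"] assms(2)] assms(3) by simp

lemma set_ideal_avoid: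
  assumes "set_ideal X I" "A \<in> I"
  obtains x where "x \<in> X" "x \<notin> A"
proof -
  have "A \<subseteq> X" "A \<noteq> X"
    using set_idealD(3)[OF assms] assms unfolding set_ideal_def by auto
  then show ?thesis using that by blast
qed

section \<open>Bounded sets and the common support of the flat balleans\<close>

text \<open>A bounded set with a point \<open>y\<close> outside the radius lies in the trivial ball
  \<open>{y}\<close> and is finite; otherwise it lies in the radius itself. Conversely, a member of
  the ideal is its own radius.\<close>

lemma bounded_point_ballean_iff:
  assumes "set_ideal X I"
  shows "bounded (point_ballean X I) A \<longleftrightarrow> A \<in> I"
proof
  assume "bounded (point_ballean X I) A"
  then obtain r where r: "A \<subseteq> X" "r \<in> I" "\<forall>y\<in>A. A \<subseteq> (if y \<in> r then r else {y})"
    by (auto simp: bounded_def point_ballean_def)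
  show "A \<in> I"
  proof (cases "A \<subseteq> r")
    case True
    then show ?thesis using r(2) set_ideal_subset[OF assms] by blast
  next
    case False
    then obtain y where "y \<in> A" "y \<notin> r" by blast
    then have "A \<subseteq> {y}" using bspec[OF r(3), of y] by simp
    then show ?thesis
      using r(1) set_ideal_finite[OF assms] by (simp add: finite_subset)
  qed
next
  assume "A \<in> I"
  then show "bounded (point_ballean X I) A"
    using set_idealD(3)[OF assms] by (auto simp: bounded_def point_ballean_def intro!: bexI[of _ A])
qed

lemma bounded_ary_ballean_iff:
  assumes "set_ideal X I"
  shows "bounded (ary_ballean X I) A \<longleftrightarrow> A \<in> I"
proof
  assume "bounded (ary_ballean X I) A"
  then obtain r where r: "A \<subseteq> X" "r \<in> I" "\<forall>y\<in>A. A \<subseteq> {y} \<union> r"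
    by (auto simp: bounded_def ary_ballean_def)
  show "A \<in> I"
  \<comment> \<open>The empty set is vacuously bounded but offers no centre \<open>y\<close>, so it
    is treated as a finite set.\<close>
  proof (cases "A = {}")
    case True
    then show ?thesis using set_ideal_finite[OF assms] by simp
  next
    case False
    then obtain y where "y \<in> A" by blast
    then have "A \<subseteq> insert y r" "insert y r \<in> I"
      using r set_ideal_insert[OF assms r(2)] by auto
    then show ?thesis using set_ideal_subset[OF assms] by blast
  qed
next
  assume "A \<in> I"
  then show "bounded (ary_ballean X I) A"
    using set_idealD(3)[OF assms] by (auto simp: bounded_def ary_ballean_def intro!: bexI[of _ A])
qed

text \<open>Together with the next lemma this shows that the flat balleans share one support, so the
  map in (iii) is an identity and the lemmas on point-fixing maps apply.\<close>

lemma support_flat_point: "set_ideal X I \<Longrightarrow> support (flat (point_ballean X I)) = I - {{}}"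
  by (auto simp: flat_def subballean_def bounded_point_ballean_iff)

lemma support_flat_ary: "set_ideal X I \<Longrightarrow> support (flat (ary_ballean X I)) = I - {{}}"
  by (auto simp: flat_def subballean_def bounded_ary_ballean_iff)

lemma ball_flat: "ball (flat B) A r = ball (hyperballean B) A r \<inter> support (flat B)"
  by (simp add: flat_def subballean_def)

lemma radii_flat: "radii (flat B) = radii B"
  by (simp add: flat_def subballean_def hyperballean_def)

section \<open>Hyperballs of the point ideal and ary structures\<close>

text \<open>A point ideal ball around \<open>x\<close> is \<open>r\<close> (when \<open>x\<close> is
  in \<open>r\<close>) or \<open>{x}\<close>, and both lie in \<open>{x} \<union> r\<close>.\<close>

lemma ball_set_point_subset_ary:
  "ball_set (point_ballean X I) A r \<subseteq> ball_set (ary_ballean X I) A r"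
  by (auto simp: ball_set_def point_ballean_def ary_ballean_def split: if_splits)

lemma mem_ball_hyperballean:
  "C \<in> ball (hyperballean B) A r \<longleftrightarrow>
    C \<subseteq> support B \<and> A \<subseteq> ball_set B C r \<and> C \<subseteq> ball_set B A r"
  by (simp add: hyperballean_def)

lemma support_hyperballean: "support (hyperballean B) = Pow (support B)"
  by (simp add: hyperballean_def)

text \<open>Both inclusions that define a hyperball are monotone in \<open>ball_set\<close>. Hence
  the radius can be kept unchanged for the coarseness claims in (i) and (iii).\<close>

lemma ball_hyperballean_point_subset_ary:
  "ball (hyperballean (point_ballean X I)) A r \<subseteq> ball (hyperballean (ary_ballean X I)) A r"
proof
  fix C assume "C \<in> ball (hyperballean (point_ballean X I)) A r"
  then have "C \<subseteq> support (ary_ballean X I)"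
    and "A \<subseteq> ball_set (point_ballean X I) C r" "C \<subseteq> ball_set (point_ballean X I) A r"
    by (simp_all add: mem_ball_hyperballean point_ballean_def ary_ballean_def)
  then show "C \<in> ball (hyperballean (ary_ballean X I)) A r"
    using ball_set_point_subset_ary order_trans unfolding mem_ball_hyperballean by metis
qed

lemma hyperballean_ary_pair_singleton:
  "x \<in> X \<Longrightarrow> {x, y} \<in> Pow X \<Longrightarrow> {x} \<in> ball (hyperballean (ary_ballean X I)) {x, y} {y}"
  by (auto simp: hyperballean_def ball_set_def ary_ballean_def)

text \<open>The point \<open>y\<close> has to lie in the ball around \<open>x\<close>, which is just
  \<open>{x}\<close> when \<open>x\<close> is outside \<open>s\<close>.\<close>

lemma hyperballean_point_pair_singletonD:
  "{x} \<in> ball (hyperballean (point_ballean X I)) {x, y} s \<Longrightarrow> x = y \<or> x \<in> s"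
  by (auto simp: hyperballean_def ball_set_def point_ballean_def split: if_splits)

text \<open>The point \<open>y\<close> is chosen before \<open>s\<close>, so the single ary radius
  \<open>{y}\<close> defeats every radius of the point ideal ballean. The sets used are non-empty
  and finite, which lets (i) and (iii) share this witness.\<close>

lemma not_hyperballean_ary_subset_point:
  assumes "set_ideal X I"
  obtains y where "y \<in> X"
    "\<And>s. s \<in> I \<Longrightarrow> \<exists>x\<in>X. {x} \<in> ball (hyperballean (ary_ballean X I)) {x, y} {y} \<and>
      {x} \<notin> ball (hyperballean (point_ballean X I)) {x, y} s"
proof -
  obtain y where y: "y \<in> X"
    using set_ideal_avoid[OF assms set_ideal_finite[OF assms, of "{}"]] by auto
  show ?thesis
  proof (rule that[OF y])
    fix s assume "s \<in> I"
    \<comment> \<open>Adding \<open>y\<close> to \<open>s\<close> stays in the proper ideal, so one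
      choice of \<open>x\<close> excludes both alternatives \<open>x = y\<close> and
      \<open>x \<in> s\<close>.\<close>
    then obtain x where x: "x \<in> X" "x \<notin> insert y s"
      using set_ideal_avoid[OF assms set_ideal_insert[OF assms _ y]] by blast
    show "\<exists>x\<in>X. {x} \<in> ball (hyperballean (ary_ballean X I)) {x, y} {y} \<and>
        {x} \<notin> ball (hyperballean (point_ballean X I)) {x, y} s"
    proof (intro bexI[of _ x] conjI notI)
      show "{x} \<in> ball (hyperballean (ary_ballean X I)) {x, y} {y}"
        using x y by (intro hyperballean_ary_pair_singleton) auto
      show False if "{x} \<in> ball (hyperballean (point_ballean X I)) {x, y} s"
        using hyperballean_point_pair_singletonD[OF that] x by blast
    qed (rule x(1))
  qed
qed

section \<open>The three identity maps\<close>

lemma coarse_hyperballean_point_ary: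
  "coarse (hyperballean (point_ballean X I)) (hyperballean (ary_ballean X I)) (exp_map id)"
proof (rule coarse_if_fixes)
  fix A r
  show "ball (hyperballean (point_ballean X I)) A r
      \<subseteq> support (hyperballean (point_ballean X I)) \<inter> ball (hyperballean (ary_ballean X I)) A r"
    using ball_hyperballean_point_subset_ary[of X I A r]
    by (auto simp: mem_ball_hyperballean support_hyperballean)
qed (auto simp: hyperballean_def point_ballean_def ary_ballean_def exp_map_def)

lemma not_asymorphism_hyperballean_point_ary:
  assumes "set_ideal X I"
  shows "\<not> asymorphism (hyperballean (point_ballean X I)) (hyperballean (ary_ballean X I))
    (exp_map id)" (is "\<not> asymorphism ?B ?C _")
proof
  assume asym: "asymorphism ?B ?C (exp_map id)"
  obtain y where y: "y \<in> X"
    "\<And>s. s \<in> I \<Longrightarrow> \<exists>x\<in>X. {x} \<in> ball ?C {x, y} {y} \<and> {x} \<notin> ball ?B {x, y} s"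
    using not_hyperballean_ary_subset_point[OF assms] by blast
  have "{y} \<in> radii ?C" using set_ideal_finite[OF assms] y(1)
    by (simp add: hyperballean_def ary_ballean_def)
  from asymorphism_fixesD[OF asym _ this] obtain s where s: "s \<in> radii ?B"
    "\<And>A D. A \<in> support ?B \<Longrightarrow> D \<in> support ?B \<Longrightarrow> D \<in> ball ?C A {y} \<Longrightarrow> D \<in> ball ?B A s"
    by (auto simp: exp_map_def)
  have "s \<in> I" using s(1) by (simp add: hyperballean_def point_ballean_def)
  then obtain x where x: "x \<in> X" "{x} \<in> ball ?C {x, y} {y}" "{x} \<notin> ball ?B {x, y} s"
    using y(2) by blast
  have "{x, y} \<in> support ?B" "{x} \<in> support ?B"
    using x(1) y(1) by (simp_all add: hyperballean_def point_ballean_def)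
  then show False using s(2) x(2,3) by blast
qed

lemma coarse_hyperballean_ary_cantor:
  "coarse (hyperballean (ary_ballean X I)) (cantor_ballean X I) id"
proof (rule coarse_if_fixes)
  fix A r
  \<comment> \<open>Equality fails when \<open>D\<close> is empty and \<open>r\<close> is not: the
    union over no centres is empty. This gap is what later prevents an asymorphism in (ii).\<close>
  have "ball_set (ary_ballean X I) D r \<subseteq> D \<union> r" for D
    by (auto simp: ball_set_def ary_ballean_def)
  then have sub: "D \<subseteq> ball_set (ary_ballean X I) E r \<Longrightarrow> D \<subseteq> E \<union> r" for D E
    by (rule order_trans[rotated])
  show "ball (hyperballean (ary_ballean X I)) A r
      \<subseteq> support (hyperballean (ary_ballean X I)) \<inter> ball (cantor_ballean X I) A r"
  proof
    fix C assume "C \<in> ball (hyperballean (ary_ballean X I)) A r"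
    then have C: "C \<subseteq> X" "A \<subseteq> C \<union> r" "C \<subseteq> A \<union> r"
      using sub by (simp_all add: mem_ball_hyperballean) (simp add: ary_ballean_def)
    then have "A - r \<subseteq> C" by blast
    with C show "C \<in> support (hyperballean (ary_ballean X I)) \<inter> ball (cantor_ballean X I) A r"
      by (simp add: support_hyperballean ary_ballean_def cantor_ballean_def)
  qed
qed (simp_all add: hyperballean_def ary_ballean_def cantor_ballean_def)

lemma not_asymorphism_hyperballean_ary_cantor:
  assumes "set_ideal X I"
  shows "\<not> asymorphism (hyperballean (ary_ballean X I)) (cantor_ballean X I) id"
    (is "\<not> asymorphism ?B ?C _")
proof
  assume asym: "asymorphism ?B ?C id"
  obtain y where y: "y \<in> X"
    using set_ideal_avoid[OF assms set_ideal_finite[OF assms, of "{}"]] by auto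
  then have "{y} \<in> radii ?C"
    using set_ideal_finite[OF assms] by (simp add: cantor_ballean_def)
  from asymorphism_fixesD[OF asym _ this] obtain s where s: "s \<in> radii ?B"
    "\<And>A D. A \<in> support ?B \<Longrightarrow> D \<in> support ?B \<Longrightarrow> D \<in> ball ?C A {y} \<Longrightarrow> D \<in> ball ?B A s"
    by auto
  \<comment> \<open>In the Cantor ballean, \<open>{y}\<close> differs from the empty set only inside
    the radius \<open>{y}\<close>. In the hyperballean, \<open>ball_set\<close> of the empty set is
    empty, so no non-empty set is close to it at any radius.\<close>
  have "{y} \<in> ball ?B {} s"
    using y by (intro s(2)) (auto simp: hyperballean_def ary_ballean_def cantor_ballean_def)
  then show False by (simp add: hyperballean_def ball_set_def)
qed

lemma coarse_flat_point_ary: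
  assumes "set_ideal X I"
  shows "coarse (flat (point_ballean X I)) (flat (ary_ballean X I))
    (flat_map (point_ballean X I) id)"
proof (rule coarse_if_fixes)
  fix A r
  show "ball (flat (point_ballean X I)) A r
      \<subseteq> support (flat (point_ballean X I)) \<inter> ball (flat (ary_ballean X I)) A r"
    using ball_hyperballean_point_subset_ary[of X I A r]
    by (auto simp: ball_flat support_flat_point[OF assms] support_flat_ary[OF assms])
  show "radii (flat (point_ballean X I)) \<subseteq> radii (flat (ary_ballean X I))"
    by (simp add: radii_flat point_ballean_def ary_ballean_def)
qed (simp_all add: support_flat_point[OF assms] support_flat_ary[OF assms] flat_map_def exp_map_def)

lemma not_asymorphism_flat_point_ary:
  assumes "set_ideal X I"
  shows "\<not> asymorphism (flat (point_ballean X I)) (flat (ary_ballean X I))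
    (flat_map (point_ballean X I) id)" (is "\<not> asymorphism ?B ?C ?f")
proof
  assume asym: "asymorphism ?B ?C ?f"
  note supp = support_flat_point[OF assms] support_flat_ary[OF assms]
  obtain y where y: "y \<in> X"
    "\<And>s. s \<in> I \<Longrightarrow> \<exists>x\<in>X. {x} \<in> ball (hyperballean (ary_ballean X I)) {x, y} {y} \<and>
      {x} \<notin> ball (hyperballean (point_ballean X I)) {x, y} s"
    using not_hyperballean_ary_subset_point[OF assms] by blast
  have "{y} \<in> radii ?C" using set_ideal_finite[OF assms] y(1)
    by (simp add: radii_flat ary_ballean_def)
  from asymorphism_fixesD[OF asym _ this] obtain s where s: "s \<in> radii ?B"
    "\<And>A D. A \<in> support ?B \<Longrightarrow> D \<in> support ?B \<Longrightarrow> D \<in> ball ?C A {y} \<Longrightarrow> D \<in> ball ?B A s"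
    by (auto simp: flat_map_def exp_map_def)
  have "s \<in> I" using s(1) by (simp add: radii_flat point_ballean_def)
  then obtain x where x: "x \<in> X" "{x} \<in> ball (hyperballean (ary_ballean X I)) {x, y} {y}"
      "{x} \<notin> ball (hyperballean (point_ballean X I)) {x, y} s"
    using y(2) by blast
  \<comment> \<open>Both witnesses are finite and non-empty, so they survive the passage to
    non-empty bounded sets.\<close>
  have "{x, y} \<in> I - {{}}" "{x} \<in> I - {{}}"
    using x(1) y(1) set_ideal_finite[OF assms] by simp_all
  then show False using s(2)[of "{x, y}" "{x}"] x(2,3) by (simp add: ball_flat supp)
qed

theorem corollary3p2:
  fixes X :: "'a set" and I :: "'a set set"
  assumes "set_ideal X I"
  shows
    "(coarse (hyperballean (point_ballean X I)) (hyperballean (ary_ballean X I)) (exp_map id) \<and>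
      \<not> asymorphism (hyperballean (point_ballean X I)) (hyperballean (ary_ballean X I)) (exp_map id))
     \<and>
     (coarse (hyperballean (ary_ballean X I)) (cantor_ballean X I) id \<and>
      \<not> asymorphism (hyperballean (ary_ballean X I)) (cantor_ballean X I) id)
     \<and>
     (coarse (flat (point_ballean X I)) (flat (ary_ballean X I))
        (flat_map (point_ballean X I) id) \<and>
      \<not> asymorphism (flat (point_ballean X I)) (flat (ary_ballean X I))
        (flat_map (point_ballean X I) id))"
  using coarse_hyperballean_point_ary not_asymorphism_hyperballean_point_ary[OF assms]
    coarse_hyperballean_ary_cantor not_asymorphism_hyperballean_ary_cantor[OF assms]
    coarse_flat_point_ary[OF assms] not_asymorphism_flat_point_ary[OF assms]
  by blast

end
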